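(* Let $A$ be a real $2\times 2$ matrix and $B$ a real $1\times 2$ matrix, and let $\mathrm{NT}=\{\vec{x}\in\mathbb{R}^2 : BA^k\vec{x}>0 \text{ for all } k\in\mathbb{N}\}$. Then $\mathrm{NT}$ is one of the following: (1) the empty set; (2) a ray from the origin, i.e. a set $\{k\vec{v}: k>0\}$ for some nonzero $\vec{v}\in\mathbb{R}^2$; (3) a sector between two rays starting from the origin, i.e. a convex set with nonempty interior satisfying $k\,\mathrm{NT}\subseteq \mathrm{NT}$ for all $k>0$.
   Context: We consider the homogeneous simple linear loop "while $(B\vec{x}>0)$ $\{\vec{x}:=A\vec{x}\}$" with program variables $\vec{x}\in\mathbb{R}^2$. Its non-termination set $\mathrm{NT}$ is the set of inputs on which the loop never terminates, namely $\mathrm{NT}=\{\vec{x}\in\mathbb{R}^2 : BA^k\vec{x}>0 \text{ for all integers } k\ge 0\}$. It is known (and may be used) that $\mathrm{NT}$ is convex. *)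

theory Defs
  imports "HOL-Analysis.Analysis"
begin

text \<open>Matrix power A^k for square real matrices.\<close>
primrec mat_pow :: "real^'n^'n \<Rightarrow> nat \<Rightarrow> real^'n^'n" where
  "mat_pow A 0 = mat 1"
| "mat_pow A (Suc k) = A ** mat_pow A k"

text \<open>Non-termination set of the loop while (B x > 0) x := A x.
  B x > 0 is meant componentwise (B has a single row here).\<close>
definition NT :: "real^2^2 \<Rightarrow> real^2^1 \<Rightarrow> (real^2) set" where
  "NT A B = {x. \<forall>k::nat. \<forall>i. ((B ** mat_pow A k) *v x) $ i > 0}"

end

theory Submission
  imports Defs
begin

(* The non-termination set NT A B consists of the vectors on which every functional
   x \<mapsto> (B A^k x)_i is strictly positive.  Any set cut out by strict positivity of a
   family of linear functionals is a convex cone (closed under positive scaling)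
   that avoids the origin; this is shown for an arbitrary family first.

   The trichotomy is then a fact about such cones in any 2-dimensional Euclidean
   space: a nonempty convex cone S with 0 \<notin> S either has nonempty interior (the
   "sector" case) or is flat.  A flat convex set lies in a hyperplane a \<bullet> x = b;
   closure under scaling forces b = 0, so S lies on the line {x. a \<bullet> x = 0}.  Every
   point of S is therefore a multiple c v of a fixed v \<in> S, and convexity together
   with 0 \<notin> S forces c > 0, i.e. S is the open ray through v.

   The theorem follows by instantiating the trichotomy with NT A B. *)

definition positivity_set :: "('i \<Rightarrow> 'a::real_vector \<Rightarrow> real) \<Rightarrow> 'a set" where
  "positivity_set f = {x. \<forall>i. 0 < f i x}"

(* NT A B is the positivity set of the functionals x \<mapsto> (B A^k x)_i, indexed by (k, i). *)
lemma NT_eq_positivity_set: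
  "NT A B = positivity_set (\<lambda>(k, i) x. ((B ** mat_pow A k) *v x) $ i)"
  unfolding NT_def positivity_set_def by auto

lemma linear_matrix_row:
  fixes M :: "real^'n^'m"
  shows "linear (\<lambda>x. (M *v x) $ i)"
  using linear_compose[OF matrix_vector_mul_linear bounded_linear_vec_nth[THEN bounded_linear.linear]]
  by (simp add: o_def)

(* A strict inequality survives convex combinations, since at least one weight is positive. *)
lemma positivity_set_convex:
  fixes f :: "'i \<Rightarrow> 'a::real_vector \<Rightarrow> real"
  assumes lin: "\<And>i. linear (f i)"
  shows "convex (positivity_set f)"
proof (rule convexI)
  fix x y :: 'a and u v :: real
  assume x: "x \<in> positivity_set f" and y: "y \<in> positivity_set f"
    and uv: "0 \<le> u" "0 \<le> v" "u + v = 1"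
  show "u *\<^sub>R x + v *\<^sub>R y \<in> positivity_set f"
    unfolding positivity_set_def mem_Collect_eq
  proof
    fix i
    have fx: "0 < f i x" and fy: "0 < f i y"
      using x y by (auto simp: positivity_set_def)
    have "f i (u *\<^sub>R x + v *\<^sub>R y) = u * f i x + v * f i y"
      using lin[of i] by (simp add: linear_add linear_scale)
    moreover have "0 < u * f i x + v * f i y"
      using uv fx fy by (smt (verit) mult_nonneg_nonneg mult_pos_pos)
    ultimately show "0 < f i (u *\<^sub>R x + v *\<^sub>R y)" by simp
  qed
qed

lemma positivity_set_cone:
  assumes lin: "\<And>i. linear (f i)" and k: "0 < k"
  shows "((*\<^sub>R) k) ` positivity_set f \<subseteq> positivity_set f"
  using k by (auto simp: positivity_set_def linear_scale[OF lin])

(* Linear functionals vanish at the origin, and the index type is nonempty. *)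
lemma zero_notin_positivity_set:
  assumes "\<And>i. linear (f i)"
  shows "0 \<notin> positivity_set f"
  by (simp add: positivity_set_def linear_0[OF assms])

(* In a convex set avoiding 0, a multiple c v of a member v can only be a member if c > 0:
   otherwise the segment from v to c v passes through the origin. *)
lemma convex_no_origin_multiple_pos:
  fixes v :: "'a::real_vector"
  assumes cvx: "convex S" and z: "0 \<notin> S" and v: "v \<in> S" and cv: "c *\<^sub>R v \<in> S"
  shows "0 < c"
proof (rule ccontr)
  assume "\<not> 0 < c"
  then have c: "c \<le> 0" by simp
  define t where "t = - c / (1 - c)"
  have t: "0 \<le> t" "t \<le> 1" using c by (auto simp: t_def field_simps)
  have "t + (1 - t) * c = 0" using c by (simp add: t_def field_simps)
  then have "t *\<^sub>R v + (1 - t) *\<^sub>R (c *\<^sub>R v) = 0"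
    by (simp add: scaleR_add_left[symmetric] del: scaleR_add_left)
  moreover have "t *\<^sub>R v + (1 - t) *\<^sub>R (c *\<^sub>R v) \<in> S"
    using convexD[OF cvx v cv] t by simp
  ultimately show False using z by simp
qed

(* In the plane a hyperplane through the origin is a line, so any two of its points with
   the second nonzero are proportional. *)
lemma planar_hyperplane_proportional:
  fixes a x v :: "'a::euclidean_space"
  assumes dim: "DIM('a) = 2" and a: "a \<noteq> 0"
    and ax: "a \<bullet> x = 0" and av: "a \<bullet> v = 0" and v: "v \<noteq> 0"
  shows "\<exists>c. x = c *\<^sub>R v"
proof -
  have "collinear {y. a \<bullet> y = 0}"
    using a dim by (simp add: collinear_aff_dim)
  then have "collinear {0, v, x}"
    by (rule collinear_subset) (use ax av in auto)
  then show ?thesis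
    using v by (cases "x = 0") (auto simp: collinear_lemma)
qed

(* A flat convex cone in the plane avoiding the origin is the open ray through any of its
   points. *)
lemma planar_flat_cone_is_ray:
  fixes S :: "'a::euclidean_space set"
  assumes dim: "DIM('a) = 2" and cvx: "convex S" and flat: "interior S = {}"
    and z: "0 \<notin> S" and cone: "\<And>k. 0 < k \<Longrightarrow> ((*\<^sub>R) k) ` S \<subseteq> S"
    and v: "v \<in> S"
  shows "S = {k *\<^sub>R v | k. k > 0}"
proof
  have scaled: "k *\<^sub>R y \<in> S" if "0 < k" "y \<in> S" for k y
    using cone[OF that(1)] that(2) by blast
  then show "{k *\<^sub>R v | k. k > 0} \<subseteq> S" using v by blast
  obtain a b where a: "a \<noteq> 0" and hyp: "S \<subseteq> {x. a \<bullet> x = b}"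
    using empty_interior_subset_hyperplane[OF cvx flat] by blast
  have "a \<bullet> v = b" "a \<bullet> (2 *\<^sub>R v) = b"
    using hyp v scaled[of 2 v] by auto
  then have b: "b = 0" by simp
  have v0: "v \<noteq> 0" using v z by auto
  show "S \<subseteq> {k *\<^sub>R v | k. k > 0}"
  proof
    fix x assume x: "x \<in> S"
    obtain c where c: "x = c *\<^sub>R v"
      using planar_hyperplane_proportional[OF dim a _ _ v0] hyp x v b by auto
    have "0 < c"
      using convex_no_origin_multiple_pos[OF cvx z v] x c by simp
    then show "x \<in> {k *\<^sub>R v | k. k > 0}" using c by blast
  qed
qed

(* The trichotomy for convex cones avoiding the origin in the plane. *)
lemma planar_cone_trichotomy:
  fixes S :: "'a::euclidean_space set"
  assumes dim: "DIM('a) = 2" and cvx: "convex S" and z: "0 \<notin> S"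
    and cone: "\<And>k. 0 < k \<Longrightarrow> ((*\<^sub>R) k) ` S \<subseteq> S"
  shows "S = {}
    \<or> (\<exists>v. v \<noteq> 0 \<and> S = {k *\<^sub>R v | k. k > 0})
    \<or> (convex S \<and> interior S \<noteq> {} \<and> (\<forall>k::real. k > 0 \<longrightarrow> ((*\<^sub>R) k) ` S \<subseteq> S))"
proof (cases "S = {} \<or> interior S \<noteq> {}")
  case True
  then show ?thesis using cvx cone by blast
next
  case False
  then obtain v where v: "v \<in> S" and flat: "interior S = {}" by blast
  have "v \<noteq> 0" using v z by auto
  then show ?thesis
    using planar_flat_cone_is_ray[OF dim cvx flat z cone v] by blast
qed

theorem proposition2:
  fixes A :: "real^2^2" and B :: "real^2^1"
  shows "NT A B = {}
    \<or> (\<exists>v::real^2. v \<noteq> 0 \<and> NT A B = {k *\<^sub>R v | k. k > 0})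
    \<or> (convex (NT A B) \<and> interior (NT A B) \<noteq> {}
        \<and> (\<forall>k::real. k > 0 \<longrightarrow> ((*\<^sub>R) k) ` NT A B \<subseteq> NT A B))"
proof -
  define f where "f = (\<lambda>(k, i) x. ((B ** mat_pow A k) *v x) $ i)"
  have lin: "linear (f j)" for j
    by (cases j) (simp add: f_def linear_matrix_row)
  have NT: "NT A B = positivity_set f"
    unfolding f_def by (rule NT_eq_positivity_set)
  show ?thesis
    unfolding NT
    by (rule planar_cone_trichotomy[OF _ positivity_set_convex zero_notin_positivity_set
          positivity_set_cone]) (simp_all add: lin)
qed

end
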